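(* In selective compound Node-Kayles under normal play, for every $n\ge 0$ the paths $P_{5n}$ and $P_{5n+4}$ are $\mathcal{P}$-positions, and the paths $P_{5n+1}$, $P_{5n+2}$ and $P_{5n+3}$ are $\mathcal{N}$-positions. Equivalently, writing $\sigma(P)=1$ if $P$ is an $\mathcal{N}$-position and $\sigma(P)=0$ if it is a $\mathcal{P}$-position, we have $\sigma(P_{5n})=\sigma(P_{5n+4})=0$ and $\sigma(P_{5n+1})=\sigma(P_{5n+2})=\sigma(P_{5n+3})=1$.
   Context: For $n\ge 0$, $P_n$ denotes the path on $n$ vertices ($P_0$ is the empty graph). A Node-Kayles move on a path $P_k$ with $k\ge 1$ chooses a vertex and deletes it together with its neighbours. The possible results are: $P_0$ if $k\in\{1,2\}$; $P_0$ or $P_1$ if $k=3$; and, for $k\ge 4$, $P_{k-2}$, $P_{k-3}$, or two paths $P_i,P_j$ with $j\ge i\ge1$, $i+j=k-3$. Selective compound Node-Kayles is played by two players who move alternately, starting from a single path. A position is a finite multiset of paths (components). A move consists in choosing any nonempty set of nonempty components and replacing each chosen component by the result of a Node-Kayles move on it; a split component yields two components. The game ends when all components are empty (long ending rule). Under normal play, the player who made the last move wins. A position is a $\mathcal{P}$-position if the second player (the one not moving next) has a winning strategy, and an $\mathcal{N}$-position otherwise. *)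

theory Defs
  imports "HOL-Library.Multiset"
begin

text \<open>
  The path on \<open>k\<close> vertices is represented by the number \<open>k\<close>, and a position by the multiset of
  the sizes of its components; empty components \<open>0\<close> are kept.
\<close>

type_synonym position = "nat multiset"

inductive nk_move :: "nat \<Rightarrow> position \<Rightarrow> bool" where
  small: "k \<in> {1, 2} \<Longrightarrow> nk_move k {#0#}"
| three_end: "nk_move 3 {#1#}"
| three_middle: "nk_move 3 {#0#}"
| end_vertex: "k \<ge> 4 \<Longrightarrow> nk_move k {#k - 2#}"
| next_to_end: "k \<ge> 4 \<Longrightarrow> nk_move k {#k - 3#}"
| split: "k \<ge> 4 \<Longrightarrow> 1 \<le> i \<Longrightarrow> i \<le> j \<Longrightarrow> i + j = k - 3 \<Longrightarrow> nk_move k {#i, j#}"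

text \<open>
  Up to empty components, these are the results of deleting a vertex \<open>v\<close> of the path
  \<open>1, \<dots>, k\<close> together with its neighbours.
\<close>

lemma nk_move_iff_delete_closed_neighbourhood:
  "(\<exists>R. nk_move k R \<and> filter_mset (\<lambda>i. 0 < i) R = S) \<longleftrightarrow>
   (\<exists>v\<in>{1..k}. S = filter_mset (\<lambda>i. 0 < i) {#card {1..<v - 1}, card {v + 2..k}#})"
    (is "?L \<longleftrightarrow> ?R")
proof
  assume ?L
  then obtain R where R: "nk_move k R" and S: "S = filter_mset (\<lambda>i. 0 < i) R" by blast
  from R show ?R
  proof cases
    case small
    then show ?thesis using S by (intro bexI[of _ 1]) auto
  next
    case three_end
    then show ?thesis using S by (intro bexI[of _ 1]) auto
  next
    case three_middle
    then show ?thesis using S by (intro bexI[of _ 2]) auto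
  next
    case end_vertex
    then show ?thesis using S by (intro bexI[of _ 1]) (auto simp: numeral_eq_Suc)
  next
    case next_to_end
    then show ?thesis using S by (intro bexI[of _ 2]) (auto simp: numeral_eq_Suc)
  next
    case (split i j)
    then have "k = i + j + 3" by simp
    then show ?thesis using S split by (intro bexI[of _ "i + 2"]) auto
  qed
next
  assume ?R
  then obtain v where v: "1 \<le> v" "v \<le> k"
    and S: "S = filter_mset (\<lambda>i. 0 < i) {#v - 2, k - v - 1#}"
    by (auto simp: numeral_eq_Suc)
  consider "k \<le> 2" | "k = 3" | "k \<ge> 4" "v = 1 \<or> v = k" | "k \<ge> 4" "v = 2 \<or> v = k - 1"
    | "k \<ge> 4" "3 \<le> v" "v \<le> k - 2" using v by linarith
  then show ?L
  proof cases
    case 1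
    then have "k \<in> {1, 2}" using v by auto
    then show ?thesis using v S by (intro exI[of _ "{#0#}"]) (auto intro: nk_move.small)
  next
    case 2
    show ?thesis
    proof (cases "v = 2")
      case True
      then show ?thesis using 2 S
        by (intro exI[of _ "{#0#}"]) (simp add: nk_move.three_middle)
    next
      case False
      then have "v = 1 \<or> v = 3" using 2 v by linarith
      then have "S = {#1#}" using 2 S by auto
      then show ?thesis using 2
        by (intro exI[of _ "{#1#}"]) (simp add: nk_move.three_end[unfolded One_nat_def])
    qed
  next
    case 3
    then have "S = {#k - 2#}" using S by (auto simp: numeral_eq_Suc)
    moreover have "nk_move k {#k - 2#}" using \<open>k \<ge> 4\<close> by (rule nk_move.end_vertex)
    ultimately show ?thesis using \<open>k \<ge> 4\<close> by (intro exI[of _ "{#k - 2#}"]) simp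
  next
    case 4
    then have "S = {#k - 3#}" using S by (auto simp: numeral_eq_Suc)
    moreover have "nk_move k {#k - 3#}" using \<open>k \<ge> 4\<close> by (rule nk_move.next_to_end)
    ultimately show ?thesis using \<open>k \<ge> 4\<close> by (intro exI[of _ "{#k - 3#}"]) simp
  next
    case 5
    let ?a = "v - 2" and ?b = "k - v - 1"
    have "nk_move k {#min ?a ?b, max ?a ?b#}"
      by (rule nk_move.split) (use 5 in auto)
    moreover have "{#min ?a ?b, max ?a ?b#} = {#?a, ?b#}"
      by (auto simp: min_def max_def add_mset_commute)
    ultimately show ?thesis using S by metis
  qed
qed

text \<open>\<open>C\<close> consists of the chosen components, \<open>Rs\<close> of the results of the moves made on them.\<close>

definition sel_move :: "position \<Rightarrow> position \<Rightarrow> bool" where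
  "sel_move G H \<longleftrightarrow>
     (\<exists>C Rs. C \<subseteq># G \<and> C \<noteq> {#} \<and> 0 \<notin># C \<and> rel_mset nk_move C Rs \<and> H = (G - C) + \<Sum>\<^sub># Rs)"

definition ended :: "position \<Rightarrow> bool" where
  "ended G \<longleftrightarrow> (\<forall>k\<in>#G. k = 0)"

lemma nk_move_exists: "k > 0 \<Longrightarrow> \<exists>R. nk_move k R"
proof -
  assume "k > 0"
  then consider "k \<in> {1, 2}" | "k = 3" | "k \<ge> 4" by fastforce
  then show ?thesis by cases (blast intro: nk_move.intros)+
qed

lemma ended_iff_no_move: "ended G \<longleftrightarrow> \<not> (\<exists>H. sel_move G H)"
proof
  assume *: "ended G"
  show "\<not> (\<exists>H. sel_move G H)"
  proof
    assume "\<exists>H. sel_move G H"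
    then obtain C where C: "C \<subseteq># G" "C \<noteq> {#}" "0 \<notin># C" by (auto simp: sel_move_def)
    then obtain k where "k \<in># C" by blast
    then show False using C * by (metis ended_def mset_subset_eqD)
  qed
next
  assume *: "\<not> (\<exists>H. sel_move G H)"
  show "ended G" unfolding ended_def
  proof (rule ballI, rule ccontr)
    fix k assume k: "k \<in># G" "k \<noteq> 0"
    then obtain R where "nk_move k R" using nk_move_exists by blast
    then have "rel_mset nk_move {#k#} {#R#}" by (simp add: rel_mset_Plus rel_mset_Zero)
    then have "sel_move G ((G - {#k#}) + \<Sum>\<^sub># {#R#})"
      unfolding sel_move_def using k by (intro exI[of _ "{#k#}"] exI[of _ "{#R#}"]) auto
    then show False using * by blast
  qed
qed

lemma nk_move_sum_less: "nk_move k R \<Longrightarrow> sum_mset R < k"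
  by (induction rule: nk_move.induct) auto

lemma rel_mset_nk_move_sum:
  "rel_mset nk_move C Rs \<Longrightarrow> sum_mset (\<Sum>\<^sub># Rs) + size C \<le> sum_mset C"
proof (induction C arbitrary: Rs)
  case empty
  then show ?case by (simp add: rel_mset_def)
next
  case (add k C)
  then obtain R Rs' where "Rs = add_mset R Rs'" "nk_move k R" "rel_mset nk_move C Rs'"
    using msed_rel_invL by metis
  then show ?case using add.IH[of Rs'] nk_move_sum_less[of k R] by simp
qed

lemma sel_move_sum_less:
  assumes "sel_move G H" shows "sum_mset H < sum_mset G"
proof -
  obtain C Rs where C: "C \<subseteq># G" "C \<noteq> {#}" "rel_mset nk_move C Rs"
    and H: "H = (G - C) + \<Sum>\<^sub># Rs"
    using assms by (auto simp: sel_move_def)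
  have "sum_mset G = sum_mset (G - C) + sum_mset C"
    by (metis C(1) subset_mset.diff_add sum_mset.union)
  moreover have "size C > 0" using C(2) by (simp add: nonempty_has_size)
  ultimately show ?thesis using rel_mset_nk_move_sum[OF C(3)] H by simp
qed

text \<open>There are no infinite plays, so it suffices to consider finite ones below.\<close>

lemma wfp_sel_move: "wfp (\<lambda>H G. sel_move G H)"
  by (rule wfp_if_convertible_to_nat[of _ sum_mset]) (rule sel_move_sum_less)

text \<open>
  A play is recorded as the list of the positions reached, the starting position first. The move
  from the position with index \<open>i\<close> is made by the first player if \<open>i\<close> is even and by the second
  player if \<open>i\<close> is odd.
\<close>

definition play :: "position \<Rightarrow> position list \<Rightarrow> bool" where
  "play G ps \<longleftrightarrow> ps \<noteq> [] \<and> hd ps = G \<and> successively sel_move ps"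

text \<open>A strategy may depend on the whole history of the play.\<close>

type_synonym strategy = "position list \<Rightarrow> position"

definition second_follows :: "strategy \<Rightarrow> position list \<Rightarrow> bool" where
  "second_follows s ps \<longleftrightarrow>
     (\<forall>i. odd i \<and> Suc i < length ps \<longrightarrow> ps ! Suc i = s (take (Suc i) ps))"

text \<open>
  The strategy has to prescribe a legal move whenever it is the second player's turn and the game
  is not over. A completed play in which \<open>length ps - 1\<close> moves were made is won by the second
  player iff this number is even; in particular, the player to move loses if the starting position
  is already over.
\<close>

definition second_winning_strategy :: "position \<Rightarrow> strategy \<Rightarrow> bool" where
  "second_winning_strategy G s \<longleftrightarrow>
     (\<forall>ps. play G ps \<and> second_follows s ps \<longrightarrow>
        (even (length ps) \<and> \<not> ended (last ps) \<longrightarrow> sel_move (last ps) (s ps)) \<and>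
        (ended (last ps) \<longrightarrow> even (length ps - 1)))"

definition P_position :: "position \<Rightarrow> bool" where
  "P_position G \<longleftrightarrow> (\<exists>s. second_winning_strategy G s)"

definition N_position :: "position \<Rightarrow> bool" where
  "N_position G \<longleftrightarrow> \<not> P_position G"

definition outcome_sigma :: "position \<Rightarrow> nat" where
  "outcome_sigma G = (if N_position G then 1 else 0)"

abbreviation single_path :: "nat \<Rightarrow> position" where
  "single_path n \<equiv> {#n#}"

end

(* In a selective compound a player may move in all components that are N-positions at once, so
   a compound is a P-position iff each of its components is one. Call lengths 0 and 4 modulo 5
   cold. If k is cold, then k - 2 is 2 or 3 and k - 3 is 1 or 2 modulo 5; neither these residues
   nor the two parts of a splitting of k - 3 can be all cold. If k is not cold, then it has a
   move to a single cold path: the empty one if k is at most 3, otherwise k - 2 or k - 3. *)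

theory Submission
  imports Defs
begin

definition cold :: "nat \<Rightarrow> bool" where
  "cold k \<longleftrightarrow> k mod 5 \<in> {0, 4}"

text \<open>Replacing a summand by its residue reduces the statements about sums below to finitely
  many evaluations.\<close>

lemma cold_mod_add: "cold (i mod 5 + j) \<longleftrightarrow> cold (i + j)"
  by (simp add: cold_def mod_add_left_eq)

lemma not_cold_add_2:
  assumes "cold i"
  shows "\<not> cold (i + 2)"
proof -
  have "\<not> cold (i mod 5 + 2)" if "i mod 5 = 0 \<or> i mod 5 = 4"
    using that by (elim disjE) (simp_all add: cold_def)
  then show ?thesis using assms unfolding cold_mod_add by (simp add: cold_def)
qed

text \<open>Two residues from 0 and 4 add up to 0, 4 or 3 modulo 5, and 3 more gives 3, 2 or 1.
  Besides splittings, the instance \<open>j = 0\<close> serves the move to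
  \<open>k - 3\<close>.\<close>

lemma not_cold_add_3:
  assumes "cold i" "cold j"
  shows "\<not> cold (i + j + 3)"
proof -
  have "\<not> cold (i mod 5 + (j mod 5 + 3))"
    if "i mod 5 = 0 \<or> i mod 5 = 4" "j mod 5 = 0 \<or> j mod 5 = 4"
    using that by (elim disjE) (simp_all add: cold_def)
  moreover have "cold (i mod 5 + (j mod 5 + 3)) \<longleftrightarrow> cold (i + j + 3)"
    by (metis cold_mod_add add.assoc add.commute)
  ultimately show ?thesis using assms by (simp add: cold_def)
qed

lemma cold_if_not_cold_add_3:
  assumes "\<not> cold (i + 3)"
  shows "cold i \<or> cold (i + 1)"
proof -
  have "i mod 5 = 0 \<or> i mod 5 = 1 \<or> i mod 5 = 2 \<or> i mod 5 = 3 \<or> i mod 5 = 4"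
    using mod_less_divisor[of 5 i] by linarith
  \<comment> \<open>The summand \<open>0\<close> gives the middle disjunct the shape that
    \<open>cold_mod_add\<close> rewrites.\<close>
  then have "cold (i mod 5 + 3) \<or> cold (i mod 5 + 0) \<or> cold (i mod 5 + 1)"
    by (elim disjE) (simp_all add: cold_def)
  then show ?thesis using assms unfolding cold_mod_add by simp
qed

lemma nk_move_cold:
  assumes "nk_move k R"
  shows "\<not> cold k \<or> (\<exists>i\<in>#R. \<not> cold i)"
  using assms
proof cases
  case small
  then have "k = 1 \<or> k = 2" by simp
  then show ?thesis by (elim disjE) (simp_all add: cold_def)
next
  case end_vertex
  then have "k - 2 + 2 = k" by simp
  then have "\<not> cold k" if "cold (k - 2)" using not_cold_add_2[OF that] by simp
  then show ?thesis using end_vertex by auto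
next
  case next_to_end
  then have "k - 3 + 0 + 3 = k" by simp
  then have "\<not> cold k" if "cold (k - 3)"
    using not_cold_add_3[OF that, of 0] by (simp add: cold_def)
  then show ?thesis using next_to_end by auto
next
  case (split i j)
  then have "i + j + 3 = k" by simp
  then show ?thesis using split(1) not_cold_add_3[of i j] by auto
qed (simp_all add: cold_def)

lemma nk_move_to_cold:
  assumes "\<not> cold k"
  shows "\<exists>i. nk_move k {#i#} \<and> cold i"
proof -
  have "k \<noteq> 0" using assms by (auto simp: cold_def)
  then consider "k \<in> {1, 2}" | "k = 3" | "k \<ge> 4" by fastforce
  then show ?thesis
  proof cases
    case 1
    then show ?thesis by (intro exI[of _ 0]) (auto intro: nk_move.small simp: cold_def)
  next
    case 2
    then show ?thesis by (intro exI[of _ 0]) (auto intro: nk_move.three_middle simp: cold_def)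
  next
    case 3
    then have "k - 3 + 3 = k" "k - 3 + 1 = k - 2" by simp_all
    then have "cold (k - 3) \<or> cold (k - 2)"
      using cold_if_not_cold_add_3[of "k - 3"] assms by simp
    then show ?thesis using nk_move.end_vertex[OF 3] nk_move.next_to_end[OF 3] by blast
  qed
qed

text \<open>Any one chosen component suffices: it is cold, so its result has a component that is
  not, and this one survives in \<open>H\<close>.\<close>

lemma sel_move_cold:
  assumes "sel_move G H" "\<forall>k\<in>#G. cold k"
  shows "\<not> (\<forall>k\<in>#H. cold k)"
proof -
  obtain C Rs where C: "C \<subseteq># G" "C \<noteq> {#}" "rel_mset nk_move C Rs"
    and H: "H = (G - C) + \<Sum>\<^sub># Rs"
    using assms(1) by (auto simp: sel_move_def)
  then obtain k C' where k: "C = add_mset k C'" by (meson multiset_cases)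
  then obtain R Rs' where R: "Rs = add_mset R Rs'" "nk_move k R"
    using C(3) msed_rel_invL by metis
  have "cold k" using assms(2) C(1) k by (meson mset_subset_eqD union_single_eq_member)
  then obtain i where "i \<in># R" "\<not> cold i" using nk_move_cold R(2) by blast
  then show ?thesis using H R(1) by auto
qed

lemma sel_move_to_cold:
  assumes "\<not> (\<forall>k\<in>#G. cold k)"
  shows "\<exists>H. sel_move G H \<and> (\<forall>k\<in>#H. cold k)"
proof -
  obtain r where r: "\<And>k. \<not> cold k \<Longrightarrow> nk_move k {#r k#} \<and> cold (r k)"
    using nk_move_to_cold by metis
  \<comment> \<open>The selective rule allows a move in all components that are not cold at
    once.\<close>
  let ?C = "filter_mset (\<lambda>k. \<not> cold k) G"
  let ?Rs = "image_mset (\<lambda>k. {#r k#}) ?C"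
  have "rel_mset nk_move ?C ?Rs"
    unfolding multiset.rel_map by (rule multiset.rel_refl_strong) (use r in auto)
  moreover have "?C \<noteq> {#}" using assms by auto
  \<comment> \<open>Length 0 is cold, so no empty component gets chosen.\<close>
  moreover have "0 \<notin># ?C" by (simp add: cold_def)
  ultimately have "sel_move G ((G - ?C) + \<Sum>\<^sub># ?Rs)"
    unfolding sel_move_def using multiset_filter_subset by blast
  moreover have "G - ?C = filter_mset cold G"
    by (metis add_diff_cancel_right' multiset_partition)
  then have "\<forall>k\<in>#(G - ?C) + \<Sum>\<^sub># ?Rs. cold k" using r by auto
  ultimately show ?thesis by blast
qed

lemma play_snoc:
  "ps \<noteq> [] \<Longrightarrow> play G (ps @ [H]) \<longleftrightarrow> play G ps \<and> sel_move (last ps) H"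
  by (auto simp: play_def successively_append_iff)

text \<open>The move to \<open>H\<close> starts at index \<open>length ps - 1\<close>, hence belongs
  to the second player iff \<open>length ps\<close> is even.\<close>

lemma second_follows_snoc:
  "ps \<noteq> [] \<Longrightarrow> second_follows s (ps @ [H]) \<longleftrightarrow>
    second_follows s ps \<and> (even (length ps) \<longrightarrow> H = s ps)"
proof -
  assume "ps \<noteq> []"
  then obtain m where m: "length ps = Suc m" by (cases ps) auto
  show ?thesis (is "?L \<longleftrightarrow> ?R")
  proof
    assume L: ?L
    have "ps ! Suc i = s (take (Suc i) ps)" if "odd i" "Suc i < length ps" for i
      using L[unfolded second_follows_def, rule_format, of i] that by (auto simp: nth_append)
    moreover have "H = s ps" if "even (length ps)"
      using L[unfolded second_follows_def, rule_format, of m] that m by (auto simp: nth_append)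
    ultimately show ?R by (auto simp: second_follows_def)
  next
    assume ?R
    then show ?L using m
      by (auto simp: second_follows_def nth_append less_Suc_eq)
  qed
qed

text \<open>\<open>Z\<close> is a kernel of the move graph. As all plays are finite, this makes it
  the set of P-positions.\<close>

context
  fixes Z :: "position \<Rightarrow> bool"
  assumes leave: "\<And>G H. sel_move G H \<Longrightarrow> Z G \<Longrightarrow> \<not> Z H"
    and enter: "\<And>G. \<not> Z G \<Longrightarrow> \<exists>H. sel_move G H \<and> Z H"
begin

lemma P_position_if_kernel:
  assumes "Z G"
  shows "P_position G"
proof -
  define s where "s ps = (SOME H. sel_move (last ps) H \<and> Z H)" for ps
  have s: "sel_move (last ps) (s ps) \<and> Z (s ps)" if "\<not> Z (last ps)" for ps
    unfolding s_def using enter[OF that] by (rule someI_ex)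
  \<comment> \<open>At odd length the first player is to move: this player always faces a position
    in \<open>Z\<close>, has to leave it, and \<open>s\<close> returns to it.\<close>
  have inv: "Z (last ps) \<longleftrightarrow> odd (length ps)" if "play G ps" "second_follows s ps" for ps
    using that
  proof (induction ps rule: rev_induct)
    case Nil
    then show ?case by (simp add: play_def)
  next
    case (snoc H ps)
    show ?case
    proof (cases "ps = []")
      case True
      then show ?thesis using snoc.prems(1) assms by (simp add: play_def)
    next
      case False
      then have "play G ps" "sel_move (last ps) H" "second_follows s ps"
        "even (length ps) \<longrightarrow> H = s ps"
        using snoc.prems by (auto simp: play_snoc second_follows_snoc)
      then show ?thesis using snoc.IH s[of ps] leave[of "last ps" H] by auto
    qed
  qed
  have "second_winning_strategy G s"
    unfolding second_winning_strategy_def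
  proof (intro allI impI conjI)
    fix ps assume ps: "play G ps \<and> second_follows s ps"
    show "sel_move (last ps) (s ps)" if "even (length ps) \<and> \<not> ended (last ps)"
      using that inv s ps by blast
    show "even (length ps - 1)" if "ended (last ps)"
    proof -
      \<comment> \<open>Outside \<open>Z\<close> there is always a move, so play can end only inside
        it.\<close>
      have "Z (last ps)" using that enter ended_iff_no_move by blast
      then show ?thesis using inv ps by simp
    qed
  qed
  then show ?thesis unfolding P_position_def by blast
qed

text \<open>Against any strategy \<open>s\<close> the first player keeps entering \<open>Z\<close>.
  The replies of \<open>s\<close> must leave it again, which cannot go on forever since the total
  length drops.\<close>

lemma N_position_if_not_kernel:
  assumes "\<not> Z G"
  shows "N_position G"
proof -
  have False if s: "second_winning_strategy G s" for s
  proof -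
    have False if "play G ps" "second_follows s ps" "odd (length ps)" "\<not> Z (last ps)" for ps
      using that
    proof (induction "sum_mset (last ps)" arbitrary: ps rule: less_induct)
      case less
      then have "ps \<noteq> []" by auto
      obtain H where H: "sel_move (last ps) H" "Z H" using enter less.prems(4) by blast
      let ?qs = "ps @ [H]" let ?K = "s ?qs"
      have qs: "play G ?qs" "second_follows s ?qs"
        using less.prems H \<open>ps \<noteq> []\<close> by (auto simp: play_snoc second_follows_snoc)
      \<comment> \<open>The play \<open>?qs\<close> has even length; if it were over, the first
        player would have made the last move.\<close>
      have "\<not> ended H"
        using s[unfolded second_winning_strategy_def, rule_format, of ?qs] qs less.prems(3) by auto
      then have K: "sel_move H ?K"
        using s[unfolded second_winning_strategy_def, rule_format, of ?qs] qs less.prems(3) by auto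
      have rs: "play G (?qs @ [?K])" "second_follows s (?qs @ [?K])"
        using qs K by (subst play_snoc second_follows_snoc; simp)+
      show False
        by (rule less.hyps[OF _ rs])
          (use less.prems H K leave sel_move_sum_less[OF H(1)] sel_move_sum_less[OF K] in auto)
    qed
    from this[of "[G]"] show False
      using assms by (simp add: play_def second_follows_def)
  qed
  then show ?thesis unfolding N_position_def P_position_def by blast
qed

end

lemma P_position_iff_cold: "P_position G \<longleftrightarrow> (\<forall>k\<in>#G. cold k)"
proof
  assume "\<forall>k\<in>#G. cold k"
  then show "P_position G"
    \<comment> \<open>The kernel conditions come first among the premises; the rotation puts the one
      on \<open>G\<close> in front for the chained fact.\<close>
    by (rule P_position_if_kernel[of "\<lambda>G. \<forall>k\<in>#G. cold k", rotated 2])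
      (fact sel_move_cold sel_move_to_cold)+
next
  assume P: "P_position G"
  show "\<forall>k\<in>#G. cold k"
  proof (rule ccontr)
    assume "\<not> (\<forall>k\<in>#G. cold k)"
    then have "N_position G"
      by (rule N_position_if_not_kernel[of "\<lambda>G. \<forall>k\<in>#G. cold k", rotated 2])
        (fact sel_move_cold sel_move_to_cold)+
    then show False using P by (simp add: N_position_def)
  qed
qed

theorem theorem6:
  fixes n :: nat
  shows "(P_position (single_path (5 * n)) \<and> P_position (single_path (5 * n + 4)) \<and>
          N_position (single_path (5 * n + 1)) \<and> N_position (single_path (5 * n + 2)) \<and>
          N_position (single_path (5 * n + 3))) \<and>
         (outcome_sigma (single_path (5 * n)) = 0 \<and> outcome_sigma (single_path (5 * n + 4)) = 0 \<and>
          outcome_sigma (single_path (5 * n + 1)) = 1 \<and> outcome_sigma (single_path (5 * n + 2)) = 1 \<and>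
          outcome_sigma (single_path (5 * n + 3)) = 1)"
proof -
  have "cold (5 * n + r) \<longleftrightarrow> cold r" for r by (simp add: cold_def)
  from this[of 0] this[of 1] this[of 2] this[of 3] this[of 4]
  have "cold (5 * n)" "\<not> cold (5 * n + 1)" "\<not> cold (5 * n + 2)" "\<not> cold (5 * n + 3)"
    "cold (5 * n + 4)"
    by (simp_all add: cold_def)
  then show ?thesis by (simp add: outcome_sigma_def N_position_def P_position_iff_cold)
qed

end
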